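(* Let $\mathcal X$ be a finite-dimensional Euclidean space, let $\kappa:\mathcal X\to\mathbb R\cup\{+\infty\}$ be a gauge, and let $\mathcal C\subseteq\mathcal X$ be a nonempty closed convex set with $0\notin\mathcal C$. Let $$v_p=\inf_x\{\kappa(x)\mid x\in\mathcal C\},\qquad v_g=\inf_y\{\kappa^\circ(y)\mid y\in\mathcal C'\}.$$ Suppose that $\operatorname{dom}\kappa^\circ\cap\mathcal C'\ne\emptyset$ and $\operatorname{ri}\operatorname{dom}\kappa\cap\operatorname{ri}\mathcal C\neq\emptyset$. Then $v_pv_g=1$ and the gauge dual problem (minimizing $\kappa^\circ(y)$ subject to $y\in\mathcal C'$) attains its optimal value.
   Context: A gauge is a nonnegative, positively homogeneous convex function $\kappa:\mathcal X\to\mathbb R\cup\{+\infty\}$ with $\kappa(0)=0$; $\operatorname{dom}\kappa=\{x\mid\kappa(x)<\infty\}$. Its polar is the gauge $\kappa^\circ(y)=\inf\{\mu>0\mid\langle x,y\rangle\le\mu\kappa(x)\ \forall x\}$ (with $\inf\emptyset=+\infty$). The antipolar of a set $\mathcal C$ is $\mathcal C'=\{y\mid\langle y,x\rangle\ge1\ \forall x\in\mathcal C\}$. $\operatorname{ri}$ denotes relative interior. *)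

theory Defs
  imports "HOL-Analysis.Analysis"
begin

text \<open>Functions into \<open>\<real> \<union> {+\<infinity>}\<close> are represented as \<^typ>\<open>ereal\<close>-valued functions; the value
  \<open>-\<infinity>\<close> is excluded for gauges by nonnegativity. The library's \<^const>\<open>convex_on\<close> and
  \<^const>\<open>epigraph\<close> only cover real-valued functions, and its \<^const>\<open>gauge\<close> is the unrelated
  notion from Henstock-Kurzweil integration. In the convexity inequality the weights are strictly
  positive; the excluded cases \<open>u = 0\<close> and \<open>v = 0\<close> hold trivially.\<close>

definition ereal_convex :: "('a::real_vector \<Rightarrow> ereal) \<Rightarrow> bool" where
  "ereal_convex f \<longleftrightarrow>
    (\<forall>x y. \<forall>u>0. \<forall>v>0. u + v = 1 \<longrightarrow>
      f (u *\<^sub>R x + v *\<^sub>R y) \<le> ereal u * f x + ereal v * f y)"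

definition gauge_function :: "('a::real_vector \<Rightarrow> ereal) \<Rightarrow> bool" where
  "gauge_function \<kappa> \<longleftrightarrow>
    (\<forall>x. 0 \<le> \<kappa> x) \<and>
    (\<forall>x. \<forall>t>0. \<kappa> (t *\<^sub>R x) = ereal t * \<kappa> x) \<and>
    ereal_convex \<kappa> \<and>
    \<kappa> 0 = 0"

definition effective_domain :: "('a \<Rightarrow> ereal) \<Rightarrow> 'a set" where
  "effective_domain f = {x. f x < \<infinity>}"

text \<open>In \<^typ>\<open>ereal\<close> the infimum of the empty set is \<open>+\<infinity>\<close>. Since \<open>\<mu> > 0\<close>, the
  constraint is vacuous at points where \<open>\<kappa>\<close> is infinite.\<close>

definition polar_gauge :: "('a::real_inner \<Rightarrow> ereal) \<Rightarrow> 'a \<Rightarrow> ereal" where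
  "polar_gauge \<kappa> y = Inf {ereal \<mu> | \<mu>. 0 < \<mu> \<and> (\<forall>x. ereal (x \<bullet> y) \<le> ereal \<mu> * \<kappa> x)}"

definition antipolar :: "'a::real_inner set \<Rightarrow> 'a set" where
  "antipolar C = {y. \<forall>x\<in>C. 1 \<le> y \<bullet> x}"

end

theory Submission
  imports Defs
begin

text \<open>Let \<open>v = v\<^sub>p\<close>. A feasible dual point of finite value bounds \<open>\<kappa>\<close> from below on \<open>C\<close>, so
  \<open>0 < v < \<infinity>\<close>. The set of all \<open>(x - c, t)\<close> with \<open>\<kappa> x \<le> t\<close> and \<open>c \<in> C\<close> is convex and has
  \<open>(0, v)\<close> in its relative boundary; the relative interior condition makes a properly supporting
  hyperplane there non-vertical, which gives \<open>z\<close> with \<open>v + z \<bullet> (x - c) \<le> \<kappa> x\<close>. By positive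
  homogeneity this splits into \<open>z \<bullet> c \<ge> v\<close> on \<open>C\<close> and \<open>z \<bullet> x \<le> \<kappa> x\<close> everywhere, so \<open>z / v\<close> is
  dual feasible with value at most \<open>1 / v\<close>, the bound given by weak duality.\<close>

lemma convex_effective_domain:
  assumes "ereal_convex f"
  shows "convex (effective_domain f)"
  unfolding convex_alt
proof (intro ballI allI impI, elim conjE)
  fix x y and u :: real
  assume xy: "x \<in> effective_domain f" "y \<in> effective_domain f" and u: "0 \<le> u" "u \<le> 1"
  show "(1 - u) *\<^sub>R x + u *\<^sub>R y \<in> effective_domain f"
  \<comment> \<open>\<open>ereal_convex\<close> covers positive weights only, so the endpoints are
    split off.\<close>
  proof (cases "u = 0 \<or> u = 1")
    case True
    then show ?thesis using xy by auto
  next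
    case False
    with u have u': "0 < 1 - u" "0 < u" by auto
    then have "f ((1 - u) *\<^sub>R x + u *\<^sub>R y) \<le> ereal (1 - u) * f x + ereal u * f y"
      using assms unfolding ereal_convex_def by (metis diff_add_cancel)
    also have "\<dots> < \<infinity>"
      using xy u' by (cases "f x"; cases "f y") (auto simp: effective_domain_def)
    finally show ?thesis by (simp add: effective_domain_def)
  qed
qed

lemma convex_ereal_epigraph:
  assumes "ereal_convex f"
  shows "convex {(x, t). f x \<le> ereal t}"
  unfolding convex_alt
proof (intro ballI allI impI, elim conjE)
  fix p q and u :: real
  assume pq: "p \<in> {(x, t). f x \<le> ereal t}" "q \<in> {(x, t). f x \<le> ereal t}"
    and u: "0 \<le> u" "u \<le> 1"
  obtain x s y t where p: "p = (x, s)" "f x \<le> ereal s" and q: "q = (y, t)" "f y \<le> ereal t"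
    using pq by (cases p; cases q) auto
  show "(1 - u) *\<^sub>R p + u *\<^sub>R q \<in> {(x, t). f x \<le> ereal t}"
  proof (cases "u = 0 \<or> u = 1")
    case True
    then show ?thesis using pq by auto
  next
    case False
    with u have u': "0 < 1 - u" "0 < u" by auto
    then have "f ((1 - u) *\<^sub>R x + u *\<^sub>R y) \<le> ereal (1 - u) * f x + ereal u * f y"
      using assms unfolding ereal_convex_def by (metis diff_add_cancel)
    also have "\<dots> \<le> ereal (1 - u) * ereal s + ereal u * ereal t"
      using u' p q by (intro add_mono ereal_mult_left_mono) auto
    finally show ?thesis by (simp add: p q)
  qed
qed

text \<open>From a relative interior point, the segment from \<open>x\<close> to \<open>x0\<close>
  extends slightly beyond \<open>x0\<close> inside \<open>S\<close>. Minimality against that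
  extension point forces the reverse inequality.\<close>

lemma inner_constant_if_min_at_rel_interior:
  fixes S :: "'a::euclidean_space set"
  assumes "convex S" and x0: "x0 \<in> rel_interior S" and le: "\<And>y. y \<in> S \<Longrightarrow> a \<bullet> x0 \<le> a \<bullet> y"
    and x: "x \<in> S"
  shows "a \<bullet> x = a \<bullet> x0"
proof -
  obtain e :: real where e: "e > 1" "(1 - e) *\<^sub>R x + e *\<^sub>R x0 \<in> S"
    using convex_rel_interior_iff[of S x0] assms by blast
  have "a \<bullet> x0 \<le> (1 - e) * (a \<bullet> x) + e * (a \<bullet> x0)"
    using le[OF e(2)] by (simp add: inner_add_right)
  then have "(e - 1) * (a \<bullet> x) \<le> (e - 1) * (a \<bullet> x0)" by (simp add: algebra_simps)
  then have "a \<bullet> x \<le> a \<bullet> x0" using e(1) by simp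
  with le[OF x] show ?thesis by simp
qed

text \<open>The slope \<open>z\<close> solves the Fenchel dual of minimizing \<open>f\<close> over
  \<open>C\<close>: the conclusion rearranges to v - z \<bullet> c \<le> f x - z \<bullet> x, with
  the variables \<open>x\<close> and \<open>c\<close> decoupled.\<close>

lemma fenchel_duality_on_set:
  fixes f :: "'a::euclidean_space \<Rightarrow> ereal"
  assumes f: "ereal_convex f" and C: "convex C"
    and ri: "rel_interior (effective_domain f) \<inter> rel_interior C \<noteq> {}"
    and v: "(INF x\<in>C. f x) = ereal v"
  obtains z where "\<And>x c. c \<in> C \<Longrightarrow> ereal (v + z \<bullet> (x - c)) \<le> f x"
proof -
  define E where "E = {(x, t). f x \<le> ereal t}"
  \<comment> \<open>Over the base point 0 the two points \<open>x\<close> and \<open>c\<close>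
    coincide, so the heights of \<open>S\<close> there have infimum \<open>v\<close>, attained or
    not.\<close>
  define S where "S = (\<Union>p\<in>E. \<Union>q\<in>C \<times> {0::real}. {p - q})"
  have S_I: "(x - c, t) \<in> S" if "f x \<le> ereal t" "c \<in> C" for x c t
    unfolding S_def E_def using that by force
  have convS: "convex S"
    unfolding S_def E_def
    by (intro convex_differences convex_ereal_epigraph f convex_Times C convex_singleton)
  have S_ge: "v \<le> t" if "(0, t) \<in> S" for t
  proof -
    from that obtain c where "c \<in> C" "f c \<le> ereal t"
      unfolding S_def E_def by auto
    then have "ereal v \<le> ereal t"
      unfolding v[symmetric] by (meson INF_lower2)
    then show ?thesis by simp
  qed
  have S_above: "(0, t) \<in> S" if t: "v < t" for t
  proof -
    have "(INF x\<in>C. f x) < ereal t" using t v by simp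
    then obtain c where "c \<in> C" "f c < ereal t" by (auto simp: INF_less_iff)
    then show ?thesis using S_I[of c t c] by simp
  qed
  have cl: "(0, v) \<in> closure S"
  proof (unfold closure_approachable, intro allI impI)
    fix e :: real assume "0 < e"
    then show "\<exists>y\<in>S. dist y (0, v) < e"
      by (intro bexI[of _ "(0, v + e / 2)"] S_above) (auto simp: dist_Pair_Pair dist_real_def)
  qed
  have notri: "(0, v) \<notin> rel_interior S"
  proof
    assume r: "(0, v) \<in> rel_interior S"
    have "S \<noteq> {}" using S_above[of "v + 1"] by auto
    \<comment> \<open>Extending the vertical segment from height \<open>v + 1\<close> past
      \<open>v\<close> stays in \<open>S\<close> but drops below \<open>v\<close>.\<close>
    then obtain e :: real where e: "e > 1" "(1 - e) *\<^sub>R (0, v + 1) + e *\<^sub>R (0, v) \<in> S"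
      using convex_rel_interior_iff[OF convS] r S_above[of "v + 1"] by force
    have "(1 - e) *\<^sub>R (0, v + 1) + e *\<^sub>R (0, v) = (0::'a, v + 1 - e)"
      by (simp add: algebra_simps)
    with e have "(0, v + 1 - e) \<in> S" by simp
    from S_ge[OF this] e(1) show False by simp
  qed
  obtain a where a_le: "\<And>y. y \<in> closure S \<Longrightarrow> a \<bullet> (0, v) \<le> a \<bullet> y"
    and a_less: "\<And>y. y \<in> rel_interior S \<Longrightarrow> a \<bullet> (0, v) < a \<bullet> y"
    using supporting_hyperplane_relative_frontier[OF convS cl notri] by metis
  obtain b \<beta> where a: "a = (b, \<beta>)" by (cases a)
  have supp: "\<beta> * v \<le> b \<bullet> (x - c) + \<beta> * t" if "f x \<le> ereal t" "c \<in> C" for x c t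
    using a_le[of "(x - c, t)"] S_I[OF that] closure_subset[of S] by (auto simp: a)
  have \<beta>0: "0 \<le> \<beta>"
    using a_le[of "(0, v + 1)"] S_above[of "v + 1"] closure_subset[of S]
    by (auto simp: a algebra_simps)
  \<comment> \<open>A vertical hyperplane would separate \<open>C\<close> from the domain of
    \<open>f\<close> by \<open>b\<close>. The common point \<open>x0\<close> minimizes
    \<open>b\<close> over the domain and maximizes it over \<open>C\<close>, so \<open>b\<close>
    takes one value on both sets and \<open>a\<close> vanishes on \<open>S\<close>, against
    strictness on the relative interior.\<close>
  have "\<beta> \<noteq> 0"
  proof
    assume 0: "\<beta> = 0"
    have dom: "\<exists>t. f x \<le> ereal t" if "x \<in> effective_domain f" for x
      using that by (cases "f x") (auto simp: effective_domain_def)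
    have le: "b \<bullet> c \<le> b \<bullet> x" if "x \<in> effective_domain f" "c \<in> C" for x c
      using dom[OF that(1)] supp[OF _ that(2)] 0 by (auto simp: inner_diff_right)
    obtain x0 where x0: "x0 \<in> rel_interior (effective_domain f)" "x0 \<in> rel_interior C"
      using ri by auto
    then have x0': "x0 \<in> effective_domain f" "x0 \<in> C"
      using rel_interior_subset by auto
    have eq1: "b \<bullet> x = b \<bullet> x0" if "x \<in> effective_domain f" for x
      using inner_constant_if_min_at_rel_interior[OF convex_effective_domain[OF f] x0(1) _ that]
        le x0' by blast
    have eq2: "b \<bullet> c = b \<bullet> x0" if "c \<in> C" for c
      using inner_constant_if_min_at_rel_interior[OF C x0(2) _ that, of "- b"] le x0' by auto
    have "rel_interior S \<noteq> {}"
      using S_above[of "v + 1"] rel_interior_eq_empty[OF convS] by auto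
    then obtain p where p: "p \<in> rel_interior S" by auto
    then have "p \<in> S" using rel_interior_subset by auto
    then obtain x c t where "p = (x - c, t)" "f x \<le> ereal t" "c \<in> C"
      unfolding S_def E_def by auto
    moreover from this have "x \<in> effective_domain f"
      by (auto simp: effective_domain_def)
    ultimately have "a \<bullet> p = 0" using eq1 eq2 by (simp add: a 0 inner_diff_right)
    with a_less[OF p] show False by (simp add: a 0)
  qed
  with \<beta>0 have \<beta>: "0 < \<beta>" by simp
  have "ereal (v + (- (b /\<^sub>R \<beta>)) \<bullet> (x - c)) \<le> f x" if "c \<in> C" for x c
  \<comment> \<open>Testing against real upper bounds \<open>t\<close> also settles the case of
    infinite \<open>f x\<close>.\<close>
  proof (rule ereal_le_real)
    fix t assume "f x \<le> ereal t"
    from supp[OF this that] \<beta> have "v \<le> (b \<bullet> (x - c)) / \<beta> + t"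
      by (simp add: field_simps)
    then show "ereal (v + (- (b /\<^sub>R \<beta>)) \<bullet> (x - c)) \<le> ereal t"
      by (simp add: field_simps)
  qed
  then show ?thesis by (rule that)
qed

lemma gauge_duality_certificate:
  fixes \<kappa> :: "'a::euclidean_space \<Rightarrow> ereal"
  assumes \<kappa>: "gauge_function \<kappa>" and C: "convex C"
    and ri: "rel_interior (effective_domain \<kappa>) \<inter> rel_interior C \<noteq> {}"
    and v: "(INF x\<in>C. \<kappa> x) = ereal v"
  obtains z where "\<And>c. c \<in> C \<Longrightarrow> v \<le> z \<bullet> c" and "\<And>x. ereal (z \<bullet> x) \<le> \<kappa> x"
proof -
  have conv: "ereal_convex \<kappa>" and \<kappa>0: "\<kappa> 0 = 0"
    and hom: "\<And>x t. 0 < t \<Longrightarrow> \<kappa> (t *\<^sub>R x) = ereal t * \<kappa> x"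
    using \<kappa> by (auto simp: gauge_function_def)
  obtain z where z: "\<And>x c. c \<in> C \<Longrightarrow> ereal (v + z \<bullet> (x - c)) \<le> \<kappa> x"
    using fenchel_duality_on_set[OF conv C ri v] by blast
  obtain c where c: "c \<in> C" using ri rel_interior_subset by auto
  \<comment> \<open>The choice x = 0 isolates the part that depends on \<open>c\<close>.\<close>
  have "v \<le> z \<bullet> c" if "c \<in> C" for c
    using z[OF that, of 0] \<kappa>0 by (simp add: zero_ereal_def)
  moreover have "ereal (z \<bullet> x) \<le> \<kappa> x" for x
  proof (rule ereal_le_real)
    fix s assume s: "\<kappa> x \<le> ereal s"
    \<comment> \<open>Along the ray through \<open>x\<close>, a linear function of \<open>t\<close>
      stays bounded above, so its slope cannot be positive.\<close>
    have scaled: "t * (z \<bullet> x - s) \<le> z \<bullet> c - v" if t: "0 < t" for t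
    proof -
      have "ereal (v + z \<bullet> (t *\<^sub>R x - c)) \<le> ereal t * \<kappa> x"
        using z[OF c, of "t *\<^sub>R x"] hom[OF t] by simp
      also have "\<dots> \<le> ereal t * ereal s" using s t by (intro ereal_mult_left_mono) auto
      finally show ?thesis by (simp add: inner_diff_right algebra_simps)
    qed
    have "z \<bullet> x \<le> s"
    proof (rule ccontr)
      assume "\<not> z \<bullet> x \<le> s"
      then have d: "0 < z \<bullet> x - s" by simp
      \<comment> \<open>At this scale the left side of \<open>scaled\<close> would exceed the right
        side by at least 1.\<close>
      have "0 < (\<bar>z \<bullet> c - v\<bar> + 1) / (z \<bullet> x - s)" using d by (intro divide_pos_pos) auto
      from scaled[OF this] d show False by simp
    qed
    then show "ereal (z \<bullet> x) \<le> ereal s" by simp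
  qed
  ultimately show ?thesis by (rule that)
qed

text \<open>Chain 1 \<le> x \<bullet> y \<le> \<mu> \<kappa>(x) and divide by \<mu>. Working with an
  admissible \<mu> > 0 instead of the polar value avoids products of zero and infinity.\<close>

lemma polar_gauge_weak_duality:
  assumes y: "y \<in> antipolar C" and \<mu>: "0 < \<mu>" "\<forall>x. ereal (x \<bullet> y) \<le> ereal \<mu> * \<kappa> x"
    and x: "x \<in> C"
  shows "ereal (1 / \<mu>) \<le> \<kappa> x"
proof -
  have "1 \<le> x \<bullet> y" using y x by (auto simp: antipolar_def inner_commute)
  then have "ereal 1 \<le> ereal \<mu> * \<kappa> x" using \<mu>(2) by (meson ereal_less_eq(3) order_trans)
  then show ?thesis using \<mu>(1) by (cases "\<kappa> x") (auto simp: field_simps)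
qed

theorem corollary5p2:
  fixes \<kappa> :: "'a::euclidean_space \<Rightarrow> ereal" and C :: "'a set" and v\<^sub>p v\<^sub>g :: ereal
  assumes "gauge_function \<kappa>"
    and "C \<noteq> {}" and "closed C" and "convex C" and "0 \<notin> C"
    and "v\<^sub>p = (INF x\<in>C. \<kappa> x)"
    and "v\<^sub>g = (INF y\<in>antipolar C. polar_gauge \<kappa> y)"
    and "effective_domain (polar_gauge \<kappa>) \<inter> antipolar C \<noteq> {}"
    and "rel_interior (effective_domain \<kappa>) \<inter> rel_interior C \<noteq> {}"
  shows "v\<^sub>p * v\<^sub>g = 1 \<and> (\<exists>y\<in>antipolar C. polar_gauge \<kappa> y = v\<^sub>g)"
proof -
  note vp = \<open>v\<^sub>p = (INF x\<in>C. \<kappa> x)\<close> and vg = \<open>v\<^sub>g = (INF y\<in>antipolar C. polar_gauge \<kappa> y)\<close>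
  have weak: "ereal (1 / \<mu>) \<le> v\<^sub>p"
    if "y \<in> antipolar C" "0 < \<mu>" "\<forall>x. ereal (x \<bullet> y) \<le> ereal \<mu> * \<kappa> x" for y \<mu>
    unfolding vp using polar_gauge_weak_duality[OF that] by (intro INF_greatest)
  obtain y0 where "y0 \<in> antipolar C" "polar_gauge \<kappa> y0 < \<infinity>"
    using \<open>effective_domain (polar_gauge \<kappa>) \<inter> antipolar C \<noteq> {}\<close>
    by (auto simp: effective_domain_def)
  \<comment> \<open>An infimum below infinity has an admissible witness, which keeps the primal
    value away from 0.\<close>
  then obtain \<mu>0 where "0 < \<mu>0" "ereal (1 / \<mu>0) \<le> v\<^sub>p"
    using weak unfolding polar_gauge_def Inf_less_iff by blast
  moreover obtain x0 where "x0 \<in> C" "\<kappa> x0 < \<infinity>"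
    using \<open>rel_interior (effective_domain \<kappa>) \<inter> rel_interior C \<noteq> {}\<close> rel_interior_subset
    by (fastforce simp: effective_domain_def)
  then have "v\<^sub>p < \<infinity>" unfolding vp INF_less_iff by blast
  moreover have "0 < ereal (1 / \<mu>0)" using \<open>0 < \<mu>0\<close> by simp
  ultimately have "0 < v\<^sub>p" "v\<^sub>p < \<infinity>" by (blast intro: less_le_trans)+
  then obtain v where v: "v\<^sub>p = ereal v" "0 < v" by (cases v\<^sub>p) auto
  obtain z where z: "\<And>c. c \<in> C \<Longrightarrow> v \<le> z \<bullet> c" "\<And>x. ereal (z \<bullet> x) \<le> \<kappa> x"
    using gauge_duality_certificate[of \<kappa> C v] assms v by metis
  \<comment> \<open>Scaling by 1 / v turns the lower bound \<open>v\<close> on \<open>C\<close> into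
    1 and makes 1 / v an admissible multiplier for the polar.\<close>
  define y where "y = z /\<^sub>R v"
  have y: "y \<in> antipolar C"
    using z(1) v(2) by (auto simp: antipolar_def y_def field_simps)
  have "ereal (x \<bullet> y) \<le> ereal (1 / v) * \<kappa> x" for x
    using z(2)[of x] v(2) by (cases "\<kappa> x") (auto simp: y_def inner_commute field_simps)
  then have "polar_gauge \<kappa> y \<le> ereal (1 / v)"
    unfolding polar_gauge_def using v(2) by (intro Inf_lower) auto
  \<comment> \<open>Every admissible \<mu> satisfies 1 / \<mu> \<le> v, hence \<mu> \<ge> 1 /
    v.\<close>
  moreover have lower: "ereal (1 / v) \<le> polar_gauge \<kappa> y'" if "y' \<in> antipolar C" for y'
    unfolding polar_gauge_def
    using weak[OF that] v by (intro Inf_greatest) (auto simp: field_simps)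
  ultimately have eq: "polar_gauge \<kappa> y = ereal (1 / v)" using y by (intro antisym) auto
  have "v\<^sub>g = ereal (1 / v)"
    unfolding vg using lower y eq by (intro antisym INF_greatest) (auto intro: INF_lower2)
  then show ?thesis using v y eq by (auto simp: one_ereal_def)
qed

end
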